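(* Let $r\ge1$ and let $m_0,\dots,m_r\ge1$, $k_1,\dots,k_r\ge0$ be integers such that (1) $m_0,m_r\ge2$; (2) $k_i\ge m_{i-1}+m_i+3$ for $2\le i\le r-1$; (3) $k_j\ge m_{j-1}+m_j+1$ for $j\in\{1,r\}$. Then the open quipu $P_{(m_0,k_1,\dots,k_r,m_r)}^{(m_0,\dots,m_r)}$ has spectral radius less than $\frac{3}{2}\sqrt2$.
   Context: Spectral radius means the largest adjacency eigenvalue. A pendant path of length $\ell$ at $v$ means new vertices $u_1,\dots,u_\ell$ and the path $vu_1\cdots u_\ell$. The tree $P_{(m_0,k_1,\dots,k_r,m_r)}^{(m_0,\dots,m_r)}$ is obtained from vertices $v_0,\dots,v_r$ by joining $v_{i-1}$ and $v_i$ ($1\le i\le r$) by a path with $k_i$ internal vertices, attaching at $v_0$ two pendant paths each of length $m_0$, at $v_r$ two pendant paths each of length $m_r$, and at each $v_i$ ($1\le i\le r-1$) one pendant path of length $m_i$. *)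

theory Defs
  imports "Graph_Theory.Graph_Theory" "Jordan_Normal_Form.Spectral_Radius"
begin

text \<open>A simple graph is a \<^locale>\<open>pair_graph\<close>: each undirected edge is a pair of opposite arcs.
  The spectrum of an adjacency matrix does not depend on how the vertices are enumerated.\<close>

definition vertex_enum :: "'a pair_pre_digraph \<Rightarrow> 'a list" where
  "vertex_enum G = (SOME vs. distinct vs \<and> set vs = pverts G)"

definition adjacency_matrix :: "'a pair_pre_digraph \<Rightarrow> real mat" where
  "adjacency_matrix G =
     mat (card (pverts G)) (card (pverts G))
       (\<lambda>(i, j). if (vertex_enum G ! i, vertex_enum G ! j) \<in> parcs G then 1 else 0)"

definition graph_spectral_radius :: "'a pair_pre_digraph \<Rightarrow> real" where
  "graph_spectral_radius G = Max (spectrum (adjacency_matrix G))"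

text \<open>\<open>Node i\<close> is $v_i$; \<open>Inner i l\<close> is the $l$-th internal vertex (from 1) of the path joining
  $v_{i-1}$ and $v_i$; \<open>Pendant i c l\<close> is the $l$-th new vertex (from 1) of the $c$-th pendant path
  (from 0) at $v_i$.\<close>

datatype quipu_vertex = Node nat | Inner nat nat | Pendant nat nat nat

definition joining_path :: "(nat \<Rightarrow> nat) \<Rightarrow> nat \<Rightarrow> quipu_vertex list" where
  "joining_path k i = Node (i - 1) # map (Inner i) [1..<k i + 1] @ [Node i]"

definition pendant_path :: "(nat \<Rightarrow> nat) \<Rightarrow> nat \<Rightarrow> nat \<Rightarrow> quipu_vertex list" where
  "pendant_path m i c = Node i # map (Pendant i c) [1..<m i + 1]"

definition num_pendant :: "nat \<Rightarrow> nat \<Rightarrow> nat" where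
  "num_pendant r i = (if i = 0 \<or> i = r then 2 else 1)"

definition quipu_paths :: "nat \<Rightarrow> (nat \<Rightarrow> nat) \<Rightarrow> (nat \<Rightarrow> nat) \<Rightarrow> quipu_vertex list set" where
  "quipu_paths r m k =
     {joining_path k i | i. 1 \<le> i \<and> i \<le> r} \<union>
     {pendant_path m i c | i c. i \<le> r \<and> c < num_pendant r i}"

definition path_arcs :: "'a list \<Rightarrow> 'a rel" where
  "path_arcs xs = set (zip xs (tl xs))"

text \<open>Only \<open>m 0, \<dots>, m r\<close> and \<open>k 1, \<dots>, k r\<close> are used.\<close>

definition open_quipu ::
    "nat \<Rightarrow> (nat \<Rightarrow> nat) \<Rightarrow> (nat \<Rightarrow> nat) \<Rightarrow> quipu_vertex pair_pre_digraph" where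
  "open_quipu r m k =
     \<lparr> pverts = (\<Union>xs \<in> quipu_paths r m k. set xs),
       parcs = (\<Union>xs \<in> quipu_paths r m k. path_arcs xs \<union> (path_arcs xs)\<inverse>) \<rparr>"

lemma finite_quipu_paths: "finite (quipu_paths r m k)"
proof -
  have "quipu_paths r m k \<subseteq>
      joining_path k ` {1..r} \<union> (\<lambda>(i, c). pendant_path m i c) ` ({..r} \<times> {..<2})"
    by (force simp: quipu_paths_def num_pendant_def split: if_splits)
  then show ?thesis
    by (rule finite_subset) simp
qed

lemma path_arcs_subset: "path_arcs xs \<subseteq> set xs \<times> set xs"
  unfolding path_arcs_def
  by (cases xs) (auto dest: set_zip_leftD set_zip_rightD)

lemma path_arcs_irrefl: "distinct xs \<Longrightarrow> (x, x) \<notin> path_arcs xs"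
  unfolding path_arcs_def
  by (auto simp: in_set_zip nth_tl distinct_conv_nth)

lemma distinct_quipu_paths: "xs \<in> quipu_paths r m k \<Longrightarrow> distinct xs"
  by (auto simp: quipu_paths_def joining_path_def pendant_path_def distinct_map inj_on_def)

lemma pair_graph_open_quipu: "pair_graph (open_quipu r m k)"
proof
  show "fst e \<in> pverts (open_quipu r m k)" "snd e \<in> pverts (open_quipu r m k)"
    if "e \<in> parcs (open_quipu r m k)" for e
    using that path_arcs_subset by (fastforce simp: open_quipu_def)+
  show "fst e \<noteq> snd e" if "e \<in> parcs (open_quipu r m k)" for e
    using that path_arcs_irrefl[OF distinct_quipu_paths]
    by (cases e) (auto simp: open_quipu_def)
  show "finite (pverts (open_quipu r m k))" "finite (parcs (open_quipu r m k))"
    by (auto simp: open_quipu_def finite_quipu_paths path_arcs_def)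
  show "symmetric (open_quipu r m k)"
    by (auto simp: symmetric_def open_quipu_def intro!: symI)
qed

end

theory Submission
  imports Defs
begin

text \<open>If a positive function $x$ on the vertices satisfies $\sum_{v \sim u} x_v \le \lambda x_u$ at
  every vertex $u$, then every eigenvalue has modulus at most $\lambda$: look at a vertex where
  $|z|/x$ is largest, for an eigenfunction $z$. Let $\lambda = \frac32\sqrt2 = t + 1/t$ with
  $t = \sqrt2$. On a path, equality holds for $t^j + B t^{-j}$. As $t + 1/t = 3/t$, the
  condition at a vertex of degree three says that the quotients of the values at its neighbours by its
  own are $1/t$ on average. On pendant paths they are smaller, which on the joining paths leaves
  room for solutions that decrease away from $v_i$ up to a distance of at most $m_i$ for
  $i \in \{0, r\}$ and of at most $m_i + 2$ otherwise. The hypotheses on the $k_i$ say that on each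
  joining path the solutions from both ends pass their minimum before they meet, so that they can be
  glued together. Finally $\lambda$ itself is not an eigenvalue, because $\lambda^2 = 9/2$ is not an
  algebraic integer.\<close>

subsection \<open>Eigenvalues of Hermitian, symmetric and integer matrices\<close>

lemma hermitian_eigenvalue_Reals:
  fixes A :: "complex mat"
  assumes A: "A \<in> carrier_mat n n" and herm: "transpose_mat A = map_mat cnj A"
    and ev: "eigenvalue A c"
  shows "c \<in> \<real>"
proof -
  obtain v where v: "v \<in> carrier_vec n" "v \<noteq> 0\<^sub>v n" and Av: "A *\<^sub>v v = c \<cdot>\<^sub>v v"
    using ev A unfolding eigenvalue_def eigenvector_def by auto
  have "map_mat cnj A *\<^sub>v conjugate v = conjugate (A *\<^sub>v v)"
    using A v(1) by (intro eq_vecI) (auto simp: scalar_prod_def cnj_sum)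
  then have conj: "transpose_mat A *\<^sub>v conjugate v = cnj c \<cdot>\<^sub>v conjugate v"
    by (simp add: herm Av conjugate_smult_vec)
  have "c * (v \<bullet>c v) = (A *\<^sub>v v) \<bullet>c v"
    using v(1) by (simp add: Av)
  also have "\<dots> = v \<bullet> (transpose_mat A *\<^sub>v conjugate v)"
    using transpose_vec_mult_scalar[of A n n v "conjugate v"] A v(1)
      comm_scalar_prod[of "transpose_mat A *\<^sub>v conjugate v" n v]
      comm_scalar_prod[of "A *\<^sub>v v" n "conjugate v"] by simp
  also have "\<dots> = cnj c * (v \<bullet>c v)"
    using v(1) by (simp add: conj)
  finally have "cnj c = c"
    using v by simp
  then show ?thesis
    by (simp add: Reals_cnj_iff)
qed

lemma spectrum_real_symmetric_non_empty:
  fixes A :: "real mat"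
  assumes A: "A \<in> carrier_mat n n" and "n > 0" and sym: "transpose_mat A = A"
  shows "spectrum A \<noteq> {}"
proof -
  let ?C = "map_mat complex_of_real A"
  have C: "?C \<in> carrier_mat n n"
    using A by simp
  obtain c where c: "eigenvalue ?C c"
    using spectrum_non_empty[OF C \<open>n > 0\<close>] by (auto simp: spectrum_def)
  have "transpose_mat ?C = map_mat complex_of_real (transpose_mat A)"
    by (rule eq_matI) auto
  then have "transpose_mat ?C = map_mat cnj ?C"
    by (auto simp: sym intro!: eq_matI)
  then obtain x where x: "c = complex_of_real x"
    using hermitian_eigenvalue_Reals[OF C _ c] by (auto elim: Reals_cases)
  have "complex_of_real (poly (char_poly A) x) = poly (char_poly ?C) c"
    by (simp add: x of_real_hom.char_poly_hom[OF A])
  also have "\<dots> = 0"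
    using c eigenvalue_root_char_poly[OF C] by simp
  finally show ?thesis
    by (auto simp: spectrum_root_char_poly[OF A])
qed

lemma eigenvalue_pow:
  assumes A: "A \<in> carrier_mat n n" and "eigenvalue A c"
  shows "eigenvalue (A ^\<^sub>m i) (c ^ i)"
proof -
  obtain v where v: "eigenvector A v c"
    using assms(2) by (auto simp: eigenvalue_def)
  then have "eigenvector (A ^\<^sub>m i) v (c ^ i)"
    using eigenvector_pow[OF A v, of i] A by (simp add: eigenvector_def)
  then show ?thesis
    by (auto simp: eigenvalue_def)
qed

lemma eigenvalue_int_mat_algebraic_int:
  fixes A :: "int mat" and c :: "'a :: field_char_0"
  assumes A: "A \<in> carrier_mat n n" and "eigenvalue (map_mat of_int A) c"
  shows "algebraic_int c"
proof -
  have "poly (char_poly (map_mat of_int A)) c = 0"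
    using assms eigenvalue_root_char_poly[of "map_mat of_int A" n c] by simp
  then have "poly (of_int_poly (char_poly A)) c = 0"
    by (simp add: of_int_hom.char_poly_hom[OF A])
  moreover have "lead_coeff (char_poly A) = 1"
    using degree_monic_char_poly[OF A] by simp
  ultimately show ?thesis
    by (auto simp: algebraic_int_altdef_ipoly)
qed

subsection \<open>Eigenvalues of adjacency matrices\<close>

lemma vertex_enum:
  assumes "finite (pverts G)"
  shows "distinct (vertex_enum G)" "set (vertex_enum G) = pverts G"
proof -
  have "\<exists>vs. distinct vs \<and> set vs = pverts G"
    using finite_distinct_list[OF assms] by blast
  then have "distinct (vertex_enum G) \<and> set (vertex_enum G) = pverts G"
    unfolding vertex_enum_def by (rule someI_ex)
  then show "distinct (vertex_enum G)" "set (vertex_enum G) = pverts G"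
    by auto
qed

lemma bij_betw_vertex_enum:
  assumes "finite (pverts G)"
  shows "bij_betw ((!) (vertex_enum G)) {..<card (pverts G)} (pverts G)"
  using vertex_enum[OF assms] distinct_card[of "vertex_enum G"] by (auto intro: bij_betw_nth)

lemma adjacency_matrix_carrier:
  "adjacency_matrix G \<in> carrier_mat (card (pverts G)) (card (pverts G))"
  by (simp add: adjacency_matrix_def)

lemma (in pair_pseudo_graph) graph_spectral_radius_eigenvalue:
  assumes "pverts G \<noteq> {}"
  shows "eigenvalue (adjacency_matrix G) (graph_spectral_radius G)"
proof -
  have "transpose_mat (adjacency_matrix G) = adjacency_matrix G"
    by (rule eq_matI) (auto simp: adjacency_matrix_def dest: arcs_symmetric)
  then have "spectrum (adjacency_matrix G) \<noteq> {}"
    using assms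
    by (intro spectrum_real_symmetric_non_empty[OF adjacency_matrix_carrier])
      (simp_all add: card_gt_0_iff pair_finite_verts)
  then have "graph_spectral_radius G \<in> spectrum (adjacency_matrix G)"
    unfolding graph_spectral_radius_def
    using card_finite_spectrum(1)[OF adjacency_matrix_carrier] by (intro Max_in)
  then show ?thesis
    by (simp add: spectrum_def)
qed

lemma adjacency_eigenvalue_pow_algebraic_int:
  assumes "eigenvalue (adjacency_matrix G) c"
  shows "algebraic_int (c ^ i)"
proof -
  let ?n = "card (pverts G)"
  define A :: "int mat" where "A = mat ?n ?n
      (\<lambda>(i, j). if (vertex_enum G ! i, vertex_enum G ! j) \<in> parcs G then 1 else 0)"
  have A: "A \<in> carrier_mat ?n ?n"
    by (simp add: A_def)
  have "adjacency_matrix G = map_mat of_int A"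
    by (auto simp: A_def adjacency_matrix_def intro!: eq_matI)
  then have "eigenvalue (map_mat of_int (A ^\<^sub>m i)) (c ^ i)"
    using eigenvalue_pow[OF adjacency_matrix_carrier assms, of i]
    by (simp add: of_int_hom.mat_hom_pow[OF A])
  then show ?thesis
    using A by (intro eigenvalue_int_mat_algebraic_int[of "A ^\<^sub>m i" ?n]) simp_all
qed

lemma three_halves_sqrt_2_not_adjacency_eigenvalue:
  "\<not> eigenvalue (adjacency_matrix G) (3 / 2 * sqrt 2)"
proof
  assume "eigenvalue (adjacency_matrix G) (3 / 2 * sqrt 2)"
  then have "algebraic_int ((3 / 2 * sqrt 2)\<^sup>2)"
    by (rule adjacency_eigenvalue_pow_algebraic_int)
  then have "algebraic_int (9 / 2 :: real)"
    by (simp add: power_mult_distrib power_divide)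
  then have "(9 / 2 :: real) \<in> \<int>"
    by (rule rational_algebraic_int_is_int) simp
  then show False
    by simp
qed

lemma (in pair_fin_digraph) adjacency_eigenfunction:
  assumes ev: "eigenvalue (adjacency_matrix G) c"
  obtains z where "\<exists>u\<in>pverts G. z u \<noteq> 0"
    "\<And>u. u \<in> pverts G \<Longrightarrow> (\<Sum>v | (u, v) \<in> parcs G. z v) = c * z u"
proof -
  let ?n = "card (pverts G)" and ?e = "(!) (vertex_enum G)"
  obtain x where x: "x \<in> carrier_vec ?n" "x \<noteq> 0\<^sub>v ?n" "adjacency_matrix G *\<^sub>v x = c \<cdot>\<^sub>v x"
    using ev adjacency_matrix_carrier[of G] unfolding eigenvalue_def eigenvector_def by auto
  have bij: "bij_betw ?e {..<?n} (pverts G)"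
    by (rule bij_betw_vertex_enum[OF pair_finite_verts])
  define z where "z u = x $ inv_into {..<?n} ?e u" for u
  have z: "z (?e i) = x $ i" if "i < ?n" for i
    using bij that by (simp add: z_def bij_betw_def inv_into_f_f)
  have "\<exists>i<?n. x $ i \<noteq> 0"
    using x(1,2) by (metis carrier_vecD eq_vecI index_zero_vec)
  then have "\<exists>u\<in>pverts G. z u \<noteq> 0"
    using z bij by (metis bij_betwE lessThan_iff)
  moreover have "(\<Sum>v | (u, v) \<in> parcs G. z v) = c * z u" if "u \<in> pverts G" for u
  proof -
    have "u \<in> ?e ` {..<?n}"
      using that bij_betw_imp_surj_on[OF bij] by simp
    then obtain i where i: "i < ?n" "u = ?e i"
      by auto
    have "(\<Sum>v | (u, v) \<in> parcs G. z v) = (\<Sum>v\<in>pverts G. if (u, v) \<in> parcs G then z v else 0)"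
      by (intro sum.mono_neutral_cong_left) (auto simp: pair_finite_verts dest: in_arcsD2)
    also have "\<dots> = (\<Sum>j<?n. if (u, ?e j) \<in> parcs G then z (?e j) else 0)"
      by (rule sum.reindex_bij_betw[OF bij, symmetric])
    also have "\<dots> = (adjacency_matrix G *\<^sub>v x) $ i"
      using i x(1)
      by (auto simp: adjacency_matrix_def scalar_prod_def z atLeast0LessThan intro!: sum.cong)
    also have "\<dots> = c * z u"
      using i x by (simp add: z)
    finally show ?thesis .
  qed
  ultimately show ?thesis
    using that by blast
qed

lemma (in pair_fin_digraph) adjacency_eigenvalue_abs_le_supersolution:
  fixes x :: "'a \<Rightarrow> real"
  assumes ev: "eigenvalue (adjacency_matrix G) c"
    and pos: "\<And>u. u \<in> pverts G \<Longrightarrow> x u > 0"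
    and super: "\<And>u. u \<in> pverts G \<Longrightarrow> (\<Sum>v | (u, v) \<in> parcs G. x v) \<le> b * x u"
  shows "\<bar>c\<bar> \<le> b"
proof -
  obtain z where z: "\<exists>u\<in>pverts G. z u \<noteq> 0"
    "\<And>u. u \<in> pverts G \<Longrightarrow> (\<Sum>v | (u, v) \<in> parcs G. z v) = c * z u"
    using adjacency_eigenfunction[OF ev] by blast
  define M where "M = Max ((\<lambda>u. \<bar>z u\<bar> / x u) ` pverts G)"
  have M_ge: "\<bar>z v\<bar> / x v \<le> M" if "v \<in> pverts G" for v
    using that by (simp add: M_def pair_finite_verts)
  have "M \<in> (\<lambda>u. \<bar>z u\<bar> / x u) ` pverts G"
    unfolding M_def using z(1) pair_finite_verts by (intro Max_in) auto
  then obtain u where u: "u \<in> pverts G" "M = \<bar>z u\<bar> / x u"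
    by blast
  obtain w where w: "w \<in> pverts G" "z w \<noteq> 0"
    using z(1) by blast
  have "0 < \<bar>z w\<bar> / x w"
    using w pos by simp
  also have "\<dots> \<le> M"
    by (rule M_ge[OF w(1)])
  finally have "M > 0" .
  have "\<bar>c\<bar> * \<bar>z u\<bar> = \<bar>\<Sum>v | (u, v) \<in> parcs G. z v\<bar>"
    using z(2)[OF u(1)] by (simp add: abs_mult)
  also have "\<dots> \<le> (\<Sum>v | (u, v) \<in> parcs G. \<bar>z v\<bar>)"
    by (rule sum_abs)
  also have "\<dots> \<le> (\<Sum>v | (u, v) \<in> parcs G. M * x v)"
    using M_ge pos by (intro sum_mono) (auto simp: pos_divide_le_eq dest: in_arcsD2)
  also have "\<dots> \<le> M * (b * x u)"
    using super[OF u(1)] \<open>M > 0\<close> by (simp flip: sum_distrib_left)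
  also have "\<dots> = b * \<bar>z u\<bar>"
    using u pos[OF u(1)] by simp
  finally show ?thesis
    using u \<open>M > 0\<close> pos[OF u(1)] by (simp add: zero_less_divide_iff)
qed

subsection \<open>Supersolutions on paths\<close>

definition path_supersolution :: "real \<Rightarrow> nat \<Rightarrow> (nat \<Rightarrow> real) \<Rightarrow> bool" where
  "path_supersolution b L f \<longleftrightarrow> (\<forall>j. 0 < j \<and> j < L \<longrightarrow> f (j - 1) + f (j + 1) \<le> b * f j)"

lemma path_supersolutionD:
  "path_supersolution b L f \<Longrightarrow> 0 < j \<Longrightarrow> j < L \<Longrightarrow> f (j - 1) + f (j + 1) \<le> b * f j"
  by (simp add: path_supersolution_def)

lemma path_supersolution_reverse:
  assumes "path_supersolution b L f"
  shows "path_supersolution b L (\<lambda>j. f (L - j))"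
  unfolding path_supersolution_def
proof (intro allI impI)
  fix j assume j: "0 < j \<and> j < L"
  then have "L - (j + 1) = L - j - 1" "L - (j - 1) = L - j + 1"
    by auto
  then show "f (L - (j - 1)) + f (L - (j + 1)) \<le> b * f (L - j)"
    using path_supersolutionD[OF assms, of "L - j"] j by simp
qed

definition glue :: "nat \<Rightarrow> (nat \<Rightarrow> real) \<Rightarrow> (nat \<Rightarrow> real) \<Rightarrow> nat \<Rightarrow> real" where
  "glue N f g j = (if j \<le> N then f j / f N else g j / g N)"

lemma glue_left: "j \<le> N \<Longrightarrow> glue N f g j = f j / f N"
  by (simp add: glue_def)

lemma glue_right: "f N \<noteq> 0 \<Longrightarrow> g N \<noteq> 0 \<Longrightarrow> N \<le> j \<Longrightarrow> glue N f g j = g j / g N"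
  by (simp add: glue_def)

lemma path_supersolution_glue:
  assumes f: "path_supersolution b L f" and g: "path_supersolution b L g"
    and pos: "f N > 0" "g N > 0"
    and half: "2 * f (N - 1) \<le> b * f N" "2 * g (N + 1) \<le> b * g N"
  shows "path_supersolution b L (glue N f g)"
  unfolding path_supersolution_def
proof (intro allI impI)
  fix j assume j: "0 < j \<and> j < L"
  have f': "(f (j - 1) + f (j + 1)) / f N \<le> b * f j / f N"
    and g': "(g (j - 1) + g (j + 1)) / g N \<le> b * g j / g N"
    using path_supersolutionD[OF f] path_supersolutionD[OF g] j pos
    by (auto intro: divide_right_mono)
  consider (left) "j < N" | (joint) "j = N" | (right) "N < j"
    by linarith
  then show "glue N f g (j - 1) + glue N f g (j + 1) \<le> b * glue N f g j"
  proof cases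
    case left
    then show ?thesis
      using f' by (simp add: glue_left add_divide_distrib)
  next
    case joint
    have "glue N f g (j - 1) + glue N f g (j + 1) = f (N - 1) / f N + g (N + 1) / g N"
      using joint pos by (simp add: glue_left glue_right)
    also have "\<dots> \<le> b / 2 + b / 2"
      using half pos by (intro add_mono) (simp_all add: divide_le_eq)
    also have "\<dots> = b * glue N f g j"
      using joint pos by (simp add: glue_left)
    finally show ?thesis .
  next
    case right
    then show ?thesis
      using g' pos by (simp add: glue_right add_divide_distrib)
  qed
qed

text \<open>For $t > 1$ and $B > 0$ the minimum of a path solution lies where $t^{2j} = B$. The solution
  with $B = -1$ vanishes at 0 and, read backwards, fits a pendant path.\<close>

definition path_solution :: "real \<Rightarrow> real \<Rightarrow> nat \<Rightarrow> real" where
  "path_solution t B j = t ^ j + B / t ^ j"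

lemma path_solution_pos: "t > 0 \<Longrightarrow> B \<ge> 0 \<Longrightarrow> path_solution t B j > 0"
  by (simp add: path_solution_def add_pos_nonneg)

lemma path_solution_minus_one_pos:
  assumes "t > 1" "j > 0"
  shows "path_solution t (-1) j > 0"
proof -
  have "t ^ j > 1"
    using assms by (simp add: one_less_power)
  moreover from this have "1 / t ^ j < 1"
    by simp
  ultimately have "1 / t ^ j < t ^ j"
    by linarith
  then show ?thesis
    by (simp add: path_solution_def)
qed

lemma path_solution_recurrence:
  assumes "t \<noteq> 0"
  shows "path_solution t B j + path_solution t B (j + 2) = (t + 1 / t) * path_solution t B (j + 1)"
  using assms by (simp add: path_solution_def field_simps)

lemma path_supersolution_path_solution:
  assumes "t \<noteq> 0"
  shows "path_supersolution (t + 1 / t) L (path_solution t B)"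
  unfolding path_supersolution_def
proof (intro allI impI)
  fix j assume "0 < j \<and> j < L"
  then show "path_solution t B (j - 1) + path_solution t B (j + 1) \<le> (t + 1 / t) * path_solution t B j"
    using path_solution_recurrence[OF assms, of B "j - 1"] by simp
qed

lemma path_solution_past_minimum:
  assumes "t \<ge> 1" "j > 0" "B \<le> t ^ (2 * j)"
  shows "2 * path_solution t B (j - 1) \<le> (t + 1 / t) * path_solution t B j"
proof -
  define y where "y = t ^ j"
  have y: "y > 0" "t ^ (j - 1) = y / t" "t ^ (j + 1) = y * t"
    using assms(1,2) by (simp_all add: y_def power_diff)
  have "t ^ (2 * j) = y\<^sup>2"
    unfolding y_def by (rule power_even_eq)
  then have "B / y \<le> y"
    using assms(3) y(1) by (simp add: divide_le_eq power2_eq_square)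
  have "path_solution t B (j + 1) - path_solution t B (j - 1) = (t - 1 / t) * (y - B / y)"
    using assms(1) y(1) unfolding path_solution_def y(2,3) by (simp add: field_simps)
  also have "\<dots> \<ge> 0"
  proof (rule mult_nonneg_nonneg)
    have "1 / t \<le> 1"
      using assms(1) by simp
    then show "0 \<le> t - 1 / t"
      using assms(1) by linarith
  qed (use \<open>B / y \<le> y\<close> in simp)
  finally show ?thesis
    using path_solution_recurrence[of t B "j - 1"] assms(1,2) by simp
qed

lemma path_solution_first_ratio:
  assumes "t \<noteq> 0" "B \<noteq> -1"
  shows "path_solution t B 1 / path_solution t B 0 = (1 + (t\<^sup>2 - 1) / (B + 1)) / t"
proof -
  have "B + 1 \<noteq> 0"
    using assms(2) by linarith
  then show ?thesis
    using assms(1) by (simp add: path_solution_def field_simps power2_eq_square)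
qed

lemma path_solution_minus_one_ratio:
  assumes "t > 1"
  shows "path_solution t (-1) m / path_solution t (-1) (m + 1) =
    (1 - (t\<^sup>2 - 1) / (t ^ (2 * (m + 1)) - 1)) / t"
proof -
  define y where "y = t ^ (m + 1)"
  have "y > 1"
    unfolding y_def using assms by (intro one_less_power) auto
  define D where "D = y\<^sup>2 - 1"
  have "D > 0"
    using \<open>y > 1\<close> by (simp add: D_def)
  have "t ^ (2 * (m + 1)) = y\<^sup>2"
    unfolding y_def by (rule power_even_eq)
  have "t ^ m = y / t"
    using assms by (simp add: y_def)
  then have numerator: "path_solution t (-1) m = (D - (t\<^sup>2 - 1)) / (y * t)"
    using \<open>y > 1\<close> assms by (simp add: D_def path_solution_def field_simps power2_eq_square)
  have denominator: "path_solution t (-1) (m + 1) = D / y"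
    using \<open>y > 1\<close> unfolding path_solution_def y_def[symmetric] D_def
    by (simp add: field_simps power2_eq_square)
  have "path_solution t (-1) m / path_solution t (-1) (m + 1) =
      (1 - (t\<^sup>2 - 1) / D) / t"
    unfolding numerator denominator using \<open>y > 1\<close> \<open>D > 0\<close> assms by (simp add: field_simps)
  then show ?thesis
    using \<open>t ^ (2 * (m + 1)) = y\<^sup>2\<close> by (simp only: D_def)
qed

definition glued_solution :: "real \<Rightarrow> real \<Rightarrow> real \<Rightarrow> nat \<Rightarrow> nat \<Rightarrow> nat \<Rightarrow> real" where
  "glued_solution t B B' N L = glue N (path_solution t B) (\<lambda>j. path_solution t B' (L - j))"

lemma glued_solution_pos:
  "t > 0 \<Longrightarrow> B \<ge> 0 \<Longrightarrow> B' \<ge> 0 \<Longrightarrow> 0 < glued_solution t B B' N L j"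
  by (simp add: glued_solution_def glue_def path_solution_pos)

lemma path_supersolution_glued_solution:
  assumes "t \<ge> 1" "B \<ge> 0" "B' \<ge> 0" "B \<le> t ^ (2 * N)" "B' \<le> t ^ (2 * (L - N))" "0 < N" "N < L"
  shows "path_supersolution (t + 1 / t) L (glued_solution t B B' N L)"
  unfolding glued_solution_def
proof (rule path_supersolution_glue)
  show "path_supersolution (t + 1 / t) L (path_solution t B)"
    using assms(1) by (intro path_supersolution_path_solution) simp
  show "path_supersolution (t + 1 / t) L (\<lambda>j. path_solution t B' (L - j))"
    using assms(1) by (intro path_supersolution_reverse path_supersolution_path_solution) simp
  show "2 * path_solution t B (N - 1) \<le> (t + 1 / t) * path_solution t B N"
    using assms by (intro path_solution_past_minimum)
  show "2 * path_solution t B' (L - (N + 1)) \<le> (t + 1 / t) * path_solution t B' (L - N)"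
    using path_solution_past_minimum[of t "L - N" B'] assms by simp
qed (use assms in \<open>simp_all add: path_solution_pos\<close>)

lemma glued_solution_first_ratio:
  assumes "t > 0" "B \<ge> 0" "0 < N"
  shows "glued_solution t B B' N L 1 / glued_solution t B B' N L 0 =
    path_solution t B 1 / path_solution t B 0"
  using assms path_solution_pos[of t B N] by (simp add: glued_solution_def glue_left)

lemma glued_solution_last_ratio:
  assumes "t > 0" "B \<ge> 0" "B' \<ge> 0" "N < L"
  shows "glued_solution t B B' N L (L - 1) / glued_solution t B B' N L L =
    path_solution t B' 1 / path_solution t B' 0"
proof -
  have "L - (L - 1) = 1"
    using assms(4) by simp
  then show ?thesis
    using assms path_solution_pos[of t B N] path_solution_pos[of t B' "L - N"]
    by (simp add: glued_solution_def glue_right)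
qed

lemma sqrt_2_plus_inverse: "sqrt 2 + 1 / sqrt 2 = 3 / 2 * sqrt 2"
  by (simp add: field_simps)

lemma sqrt_2_power_even: "sqrt 2 ^ (2 * n) = 2 ^ n"
  by (simp add: power_mult)

text \<open>A branch vertex of an open quipu has degree three: $p$ of its neighbours lie on pendant paths
  and $3 - p$ on joining paths. The parameter $B$ below is the one for which the solutions around the
  vertex satisfy the eigenvalue equation for $\frac32\sqrt2$ there, see \<open>node_balance\<close>.\<close>

definition balance_parameter :: "nat \<Rightarrow> nat \<Rightarrow> real" where
  "balance_parameter p m = real (3 - p) / real p * (2 ^ (m + 1) - 1) - 1"

definition turning_distance :: "nat \<Rightarrow> nat \<Rightarrow> nat" where
  "turning_distance p m = (if p = 2 then m else m + 2)"

lemma balance_parameter_le: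
  assumes "p \<in> {1, 2}"
  shows "balance_parameter p m \<le> 2 ^ turning_distance p m"
  using assms by (auto simp: balance_parameter_def turning_distance_def field_simps)

lemma balance_parameter_nonneg:
  assumes "p \<in> {1, 2}" "m \<ge> 1"
  shows "balance_parameter p m \<ge> 0"
proof -
  have "(2::real) ^ 1 \<le> 2 ^ m"
    using assms(2) by (intro power_increasing) auto
  then show ?thesis
    using assms(1) by (auto simp: balance_parameter_def field_simps)
qed

lemma node_balance:
  fixes p m :: nat
  defines "B \<equiv> balance_parameter p m"
  assumes "p \<in> {1, 2}"
  shows "real p * (path_solution (sqrt 2) (-1) m / path_solution (sqrt 2) (-1) (m + 1)) +
    real (3 - p) * (path_solution (sqrt 2) B 1 / path_solution (sqrt 2) B 0) = 3 / 2 * sqrt 2"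
proof -
  define M :: real where "M = 2 ^ (m + 1)"
  have "M > 1"
    unfolding M_def by (rule one_less_power) auto
  have "B + 1 = real (3 - p) / real p * (M - 1)"
    by (simp add: B_def balance_parameter_def M_def)
  then have cancel: "real p / (M - 1) = real (3 - p) / (B + 1)" and "B \<noteq> -1"
    using assms(2) \<open>M > 1\<close> by (auto simp: field_simps)
  have "path_solution (sqrt 2) (-1) m / path_solution (sqrt 2) (-1) (m + 1) =
      (1 - 1 / (M - 1)) / sqrt 2"
    using path_solution_minus_one_ratio[of "sqrt 2" m] unfolding sqrt_2_power_even M_def by simp
  moreover have "path_solution (sqrt 2) B 1 / path_solution (sqrt 2) B 0 = (1 + 1 / (B + 1)) / sqrt 2"
    by (subst path_solution_first_ratio) (use \<open>B \<noteq> -1\<close> in auto)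
  ultimately have "real p * (path_solution (sqrt 2) (-1) m / path_solution (sqrt 2) (-1) (m + 1)) +
      real (3 - p) * (path_solution (sqrt 2) B 1 / path_solution (sqrt 2) B 0) =
      (real p + real (3 - p) - real p / (M - 1) + real (3 - p) / (B + 1)) / sqrt 2"
    by (simp only: add_divide_distrib diff_divide_distrib ring_distribs) simp
  also have "\<dots> = 3 / sqrt 2"
    using assms(2) by (auto simp: cancel)
  also have "\<dots> = 3 / 2 * sqrt 2"
    by (simp add: field_simps)
  finally show ?thesis .
qed

subsection \<open>Open quipus\<close>

definition joining_vertex :: "(nat \<Rightarrow> nat) \<Rightarrow> nat \<Rightarrow> nat \<Rightarrow> quipu_vertex" where
  "joining_vertex k i j =
     (if j = 0 then Node (i - 1) else if j = k i + 1 then Node i else Inner i j)"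

definition pendant_vertex :: "nat \<Rightarrow> nat \<Rightarrow> nat \<Rightarrow> quipu_vertex" where
  "pendant_vertex i c j = (if j = 0 then Node i else Pendant i c j)"

lemma joining_path_conv_map: "joining_path k i = map (joining_vertex k i) [0..<(k i + 1) + 1]"
proof -
  have "[0..<(k i + 1) + 1] = 0 # [1..<k i + 1] @ [k i + 1]"
    by (simp add: upt_conv_Cons)
  then show ?thesis
    by (simp add: joining_path_def joining_vertex_def del: upt_Suc)
qed

lemma pendant_path_conv_map: "pendant_path m i c = map (pendant_vertex i c) [0..<m i + 1]"
proof -
  have "[0..<m i + 1] = 0 # [1..<m i + 1]"
    by (simp add: upt_conv_Cons del: upt_Suc)
  then show ?thesis
    by (simp add: pendant_path_def pendant_vertex_def del: upt_Suc)
qed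

lemma path_arcs_map_upt: "path_arcs (map f [0..<n + 1]) = {(f j, f (j + 1)) | j. j < n}"
  by (force simp: path_arcs_def set_zip nth_tl simp del: upt_Suc)

lemma pverts_open_quipu_cases:
  assumes "u \<in> pverts (open_quipu r m k)"
  obtains (Node) i where "i \<le> r" "u = Node i"
  | (Inner) i l where "1 \<le> i" "i \<le> r" "1 \<le> l" "l \<le> k i" "u = Inner i l"
  | (Pendant) i c l where "i \<le> r" "c < num_pendant r i" "1 \<le> l" "l \<le> m i" "u = Pendant i c l"
  using assms
  by (fastforce simp: open_quipu_def quipu_paths_def joining_path_def pendant_path_def simp del: upt_Suc)

lemma pverts_open_quipu_not_empty: "pverts (open_quipu r m k) \<noteq> {}"
proof -
  have "pendant_path m 0 0 \<in> quipu_paths r m k"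
    unfolding quipu_paths_def
    by (intro UnI2 CollectI exI[of _ 0] conjI) (simp_all add: num_pendant_def)
  moreover have "Node 0 \<in> set (pendant_path m 0 0)"
    by (simp add: pendant_path_def)
  ultimately have "Node 0 \<in> pverts (open_quipu r m k)"
    by (auto simp: open_quipu_def)
  then show ?thesis
    by auto
qed

lemma parcs_open_quipu_iff:
  "(u, v) \<in> parcs (open_quipu r m k) \<longleftrightarrow>
    (\<exists>i j. 1 \<le> i \<and> i \<le> r \<and> j \<le> k i \<and>
      {u, v} = {joining_vertex k i j, joining_vertex k i (j + 1)}) \<or>
    (\<exists>i c j. i \<le> r \<and> c < num_pendant r i \<and> j < m i \<and>
      {u, v} = {pendant_vertex i c j, pendant_vertex i c (j + 1)})"
  (is "_ \<longleftrightarrow> ?edge")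
proof -
  have joining: "path_arcs (joining_path k i) =
      {(joining_vertex k i j, joining_vertex k i (j + 1)) | j. j \<le> k i}" for i
    unfolding joining_path_conv_map path_arcs_map_upt by (simp add: less_Suc_eq_le)
  have pendant: "path_arcs (pendant_path m i c) =
      {(pendant_vertex i c j, pendant_vertex i c (j + 1)) | j. j < m i}" for i c
    unfolding pendant_path_conv_map path_arcs_map_upt ..
  let ?edges = "\<lambda>xs. path_arcs xs \<union> (path_arcs xs)\<inverse>"
  have "(u, v) \<in> parcs (open_quipu r m k) \<longleftrightarrow> (\<exists>xs\<in>quipu_paths r m k. (u, v) \<in> ?edges xs)"
    by (simp add: open_quipu_def)
  also have "\<dots> \<longleftrightarrow> (\<exists>i. 1 \<le> i \<and> i \<le> r \<and> (u, v) \<in> ?edges (joining_path k i)) \<or>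
      (\<exists>i c. i \<le> r \<and> c < num_pendant r i \<and> (u, v) \<in> ?edges (pendant_path m i c))"
    unfolding quipu_paths_def by blast
  also have "\<dots> \<longleftrightarrow> ?edge"
    unfolding joining pendant doubleton_eq_iff by blast
  finally show ?thesis .
qed

lemma open_quipu_neighbours_Node:
  assumes "n \<le> r" "1 \<le> m n"
  shows "{v. (Node n, v) \<in> parcs (open_quipu r m k)} =
    (\<lambda>c. Pendant n c 1) ` {..<num_pendant r n} \<union>
    (if 1 \<le> n then {joining_vertex k n (k n)} else {}) \<union>
    (if n < r then {joining_vertex k (n + 1) 1} else {})" (is "?N = ?R")
proof (rule Set.set_eqI)
  fix v
  have joining_end: "Node n = joining_vertex k i j \<longleftrightarrow> j = 0 \<and> n = i - 1 \<or> j = k i + 1 \<and> n = i" for i j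
    by (auto simp: joining_vertex_def)
  have pendant_end: "Node n = pendant_vertex i c j \<longleftrightarrow> j = 0 \<and> n = i" for i c j
    by (auto simp: pendant_vertex_def)
  have "v \<in> ?N \<longleftrightarrow>
     (n < r \<and> v = joining_vertex k (n + 1) 1) \<or> (1 \<le> n \<and> v = joining_vertex k n (k n)) \<or>
     (\<exists>c < num_pendant r n. v = pendant_vertex n c 1)"
    unfolding mem_Collect_eq parcs_open_quipu_iff doubleton_eq_iff joining_end pendant_end
    using assms by (auto 4 4 intro: exI[of _ "n + 1"])
  then show "v \<in> ?N \<longleftrightarrow> v \<in> ?R"
    by (auto simp: pendant_vertex_def)
qed

lemma open_quipu_neighbours_Inner:
  assumes "1 \<le> i" "i \<le> r" "1 \<le> l" "l \<le> k i"
  shows "{v. (Inner i l, v) \<in> parcs (open_quipu r m k)} =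
    {joining_vertex k i (l - 1), joining_vertex k i (l + 1)}"
proof (rule Set.set_eqI)
  fix v
  have joining: "Inner i l = joining_vertex k i' j \<longleftrightarrow> i = i' \<and> j = l" for i' j
    using assms by (auto simp: joining_vertex_def)
  have pendant: "Inner i l \<noteq> pendant_vertex i' c j" for i' c j
    by (simp add: pendant_vertex_def)
  show "v \<in> {v. (Inner i l, v) \<in> parcs (open_quipu r m k)} \<longleftrightarrow>
      v \<in> {joining_vertex k i (l - 1), joining_vertex k i (l + 1)}"
    unfolding mem_Collect_eq parcs_open_quipu_iff doubleton_eq_iff joining
    using assms pendant by (cases l) (auto simp: conj_disj_distribL ex_disj_distrib)
qed

lemma open_quipu_neighbours_Pendant:
  assumes "i \<le> r" "c < num_pendant r i" "1 \<le> l" "l \<le> m i"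
  shows "{v. (Pendant i c l, v) \<in> parcs (open_quipu r m k)} =
    insert (pendant_vertex i c (l - 1)) (if l < m i then {pendant_vertex i c (l + 1)} else {})"
proof (rule Set.set_eqI)
  fix v
  have joining: "Pendant i c l \<noteq> joining_vertex k i' j" for i' j
    by (simp add: joining_vertex_def)
  have pendant: "Pendant i c l = pendant_vertex i' c' j \<longleftrightarrow> i = i' \<and> c = c' \<and> j = l" for i' c' j
    using assms by (auto simp: pendant_vertex_def)
  show "v \<in> {v. (Pendant i c l, v) \<in> parcs (open_quipu r m k)} \<longleftrightarrow>
      v \<in> insert (pendant_vertex i c (l - 1)) (if l < m i then {pendant_vertex i c (l + 1)} else {})"
    unfolding mem_Collect_eq parcs_open_quipu_iff doubleton_eq_iff pendant
    using assms joining by (cases l) (auto simp: conj_disj_distribL ex_disj_distrib)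
qed

text \<open>The functions \<open>W i\<close> and \<open>P i\<close> live on the \<open>i\<close>-th joining path and on the pendant paths at $v_i$.
  They need not agree at $v_i$, since only quotients of their values matter: the graph is a tree, so
  they can be rescaled, from $v_0$ onwards, to a function on its vertices.\<close>

locale open_quipu_potentials =
  fixes r :: nat and m k :: "nat \<Rightarrow> nat" and W P :: "nat \<Rightarrow> nat \<Rightarrow> real" and b :: real
  assumes pendant_length_pos: "i \<le> r \<Longrightarrow> 1 \<le> m i"
    and joining_pos: "1 \<le> i \<Longrightarrow> i \<le> r \<Longrightarrow> j \<le> k i + 1 \<Longrightarrow> 0 < W i j"
    and pendant_pos: "i \<le> r \<Longrightarrow> j \<le> m i \<Longrightarrow> 0 < P i j"
    and pendant_end_nonneg: "i \<le> r \<Longrightarrow> 0 \<le> P i (m i + 1)"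
    and joining_supersolution: "1 \<le> i \<Longrightarrow> i \<le> r \<Longrightarrow> path_supersolution b (k i + 1) (W i)"
    and pendant_supersolution: "i \<le> r \<Longrightarrow> path_supersolution b (m i + 1) (P i)"
    and node_ratios_le: "i \<le> r \<Longrightarrow>
      real (num_pendant r i) * (P i 1 / P i 0) +
      (if 1 \<le> i then W i (k i) / W i (k i + 1) else 0) +
      (if i < r then W (i + 1) 1 / W (i + 1) 0 else 0) \<le> b"
begin

primrec node_potential :: "nat \<Rightarrow> real" where
  "node_potential 0 = 1"
| "node_potential (Suc i) = node_potential i * (W (Suc i) (k (Suc i) + 1) / W (Suc i) 0)"

primrec potential :: "quipu_vertex \<Rightarrow> real" where
  "potential (Node i) = node_potential i"
| "potential (Inner i j) = node_potential (i - 1) / W i 0 * W i j"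
| "potential (Pendant i c j) = node_potential i / P i 0 * P i j"

lemma node_potential_pos: "i \<le> r \<Longrightarrow> 0 < node_potential i"
  by (induction i) (simp_all add: joining_pos)

lemma potential_joining_vertex:
  assumes "1 \<le> i" "i \<le> r"
  shows "potential (joining_vertex k i j) = node_potential (i - 1) / W i 0 * W i j"
proof -
  have "W i 0 > 0"
    using assms by (intro joining_pos) auto
  moreover have "node_potential i = node_potential (i - 1) * (W i (k i + 1) / W i 0)"
    using assms by (cases i) auto
  ultimately show ?thesis
    by (simp add: joining_vertex_def)
qed

lemma potential_joining_vertex_last:
  assumes "1 \<le> i" "i \<le> r"
  shows "potential (joining_vertex k i (k i)) = node_potential i * (W i (k i) / W i (k i + 1))"
proof -
  have "node_potential i = node_potential (i - 1) / W i 0 * W i (k i + 1)"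
    using potential_joining_vertex[OF assms, of "k i + 1"] by (simp add: joining_vertex_def)
  then show ?thesis
    using joining_pos[OF assms, of "k i + 1"] by (simp add: potential_joining_vertex[OF assms])
qed

lemma potential_pendant_vertex:
  assumes "i \<le> r"
  shows "potential (pendant_vertex i c j) = node_potential i / P i 0 * P i j"
  using pendant_pos[OF assms, of 0] by (simp add: pendant_vertex_def)

lemma potential_pos:
  assumes "u \<in> pverts (open_quipu r m k)"
  shows "0 < potential u"
  using assms
proof (cases rule: pverts_open_quipu_cases)
  case (Node i)
  then show ?thesis
    by (simp add: node_potential_pos)
next
  case (Inner i l)
  then show ?thesis
    using node_potential_pos[of "i - 1"] joining_pos[of i 0] joining_pos[of i l] by simp
next
  case (Pendant i c l)
  then show ?thesis
    using node_potential_pos[of i] pendant_pos[of i 0] pendant_pos[of i l] by simp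
qed

lemma potential_supersolution_Node:
  assumes "i \<le> r"
  shows "(\<Sum>v | (Node i, v) \<in> parcs (open_quipu r m k). potential v) \<le> b * potential (Node i)"
proof -
  let ?pendants = "(\<lambda>c. Pendant i c 1) ` {..<num_pendant r i}"
  let ?left = "if 1 \<le> i then {joining_vertex k i (k i)} else {}"
  let ?right = "if i < r then {joining_vertex k (i + 1) 1} else {}"
  let ?x = "node_potential i"
  have disjoint: "(?pendants \<union> ?left) \<inter> ?right = {}" "?pendants \<inter> ?left = {}"
    by (auto simp: joining_vertex_def split: if_splits)
  have "(\<Sum>v | (Node i, v) \<in> parcs (open_quipu r m k). potential v) =
      sum potential (?pendants \<union> ?left \<union> ?right)"
    by (subst open_quipu_neighbours_Node) (use assms pendant_length_pos in auto)
  also have "\<dots> = sum potential ?pendants + sum potential ?left + sum potential ?right"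
    using disjoint by (simp add: sum.union_disjoint)
  also have "sum potential ?pendants = real (num_pendant r i) * (?x / P i 0 * P i 1)"
    by (subst sum.reindex) (simp_all add: inj_on_def)
  also have "sum potential ?left = ?x * (if 1 \<le> i then W i (k i) / W i (k i + 1) else 0)"
    using assms by (simp add: potential_joining_vertex_last)
  also have "sum potential ?right = ?x * (if i < r then W (i + 1) 1 / W (i + 1) 0 else 0)"
    using potential_joining_vertex[of "i + 1" 1] by simp
  also have "real (num_pendant r i) * (?x / P i 0 * P i 1) +
      ?x * (if 1 \<le> i then W i (k i) / W i (k i + 1) else 0) +
      ?x * (if i < r then W (i + 1) 1 / W (i + 1) 0 else 0) \<le> b * ?x"
    using mult_left_mono[OF node_ratios_le[OF assms], of ?x] node_potential_pos[OF assms]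
    by (simp add: algebra_simps)
  finally show ?thesis
    by simp
qed

lemma potential_supersolution_Inner:
  assumes "1 \<le> i" "i \<le> r" "1 \<le> l" "l \<le> k i"
  shows "(\<Sum>v | (Inner i l, v) \<in> parcs (open_quipu r m k). potential v) \<le> b * potential (Inner i l)"
proof -
  define a where "a = node_potential (i - 1) / W i 0"
  have "a \<ge> 0"
    using assms node_potential_pos[of "i - 1"] joining_pos[of i 0]
    by (simp add: a_def divide_nonneg_pos less_imp_le)
  have "joining_vertex k i (l - 1) \<noteq> joining_vertex k i (l + 1)"
    using assms by (auto simp: joining_vertex_def)
  then have "(\<Sum>v | (Inner i l, v) \<in> parcs (open_quipu r m k). potential v) =
      a * (W i (l - 1) + W i (l + 1))"
    using assms
    by (simp add: open_quipu_neighbours_Inner potential_joining_vertex a_def distrib_left)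
  also have "\<dots> \<le> a * (b * W i l)"
    using assms \<open>a \<ge> 0\<close>
    by (intro mult_left_mono path_supersolutionD[OF joining_supersolution]) auto
  finally show ?thesis
    by (simp add: a_def mult_ac)
qed

lemma potential_supersolution_Pendant:
  assumes "i \<le> r" "c < num_pendant r i" "1 \<le> l" "l \<le> m i"
  shows "(\<Sum>v | (Pendant i c l, v) \<in> parcs (open_quipu r m k). potential v)
    \<le> b * potential (Pendant i c l)"
proof -
  define a where "a = node_potential i / P i 0"
  have "a \<ge> 0"
    using assms node_potential_pos[of i] pendant_pos[of i 0] by (simp add: a_def)
  have "pendant_vertex i c (l - 1) \<noteq> pendant_vertex i c (l + 1)"
    using assms by (auto simp: pendant_vertex_def)
  then have "(\<Sum>v | (Pendant i c l, v) \<in> parcs (open_quipu r m k). potential v) =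
      a * (P i (l - 1) + (if l < m i then P i (l + 1) else 0))"
    using assms
    by (simp add: open_quipu_neighbours_Pendant potential_pendant_vertex a_def distrib_left)
  also have "\<dots> \<le> a * (P i (l - 1) + P i (l + 1))"
    using assms \<open>a \<ge> 0\<close> pendant_end_nonneg[of i]
    by (intro mult_left_mono add_left_mono) (auto simp: not_less)
  also have "\<dots> \<le> a * (b * P i l)"
    using assms \<open>a \<ge> 0\<close>
    by (intro mult_left_mono path_supersolutionD[OF pendant_supersolution]) auto
  finally show ?thesis
    by (simp add: a_def mult_ac)
qed

lemma open_quipu_eigenvalue_abs_le:
  assumes "eigenvalue (adjacency_matrix (open_quipu r m k)) c"
  shows "\<bar>c\<bar> \<le> b"
proof -
  interpret pair_graph "open_quipu r m k"
    by (rule pair_graph_open_quipu)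
  show ?thesis
  proof (rule adjacency_eigenvalue_abs_le_supersolution[OF assms, of potential])
    fix u assume u: "u \<in> pverts (open_quipu r m k)"
    then show "0 < potential u"
      by (rule potential_pos)
    from u show "(\<Sum>v | (u, v) \<in> parcs (open_quipu r m k). potential v) \<le> b * potential u"
      by (cases rule: pverts_open_quipu_cases)
        (simp_all only: potential_supersolution_Node potential_supersolution_Inner
          potential_supersolution_Pendant)
  qed
qed

end

locale well_spaced_quipu =
  fixes r :: nat and m k :: "nat \<Rightarrow> nat"
  assumes r_pos: "1 \<le> r"
    and m_pos: "i \<le> r \<Longrightarrow> 1 \<le> m i"
    and spacing: "1 \<le> i \<Longrightarrow> i \<le> r \<Longrightarrow>
      turning_distance (num_pendant r (i - 1)) (m (i - 1)) +
      turning_distance (num_pendant r i) (m i) \<le> k i + 1"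
begin

definition node_parameter :: "nat \<Rightarrow> real" where
  "node_parameter i = balance_parameter (num_pendant r i) (m i)"

definition node_distance :: "nat \<Rightarrow> nat" where
  "node_distance i = turning_distance (num_pendant r i) (m i)"

definition joining_potential :: "nat \<Rightarrow> nat \<Rightarrow> real" where
  "joining_potential i =
     glued_solution (sqrt 2) (node_parameter (i - 1)) (node_parameter i)
       (node_distance (i - 1)) (k i + 1)"

definition pendant_potential :: "nat \<Rightarrow> nat \<Rightarrow> real" where
  "pendant_potential i j = path_solution (sqrt 2) (-1) (m i + 1 - j)"

lemma num_pendant_cases: "num_pendant r i \<in> {1, 2}"
  by (simp add: num_pendant_def)

lemma node_parameter_nonneg: "i \<le> r \<Longrightarrow> 0 \<le> node_parameter i"
  unfolding node_parameter_def by (intro balance_parameter_nonneg num_pendant_cases m_pos)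

lemma node_parameter_le: "node_distance i \<le> n \<Longrightarrow> node_parameter i \<le> 2 ^ n"
  unfolding node_parameter_def node_distance_def
  by (rule order_trans[OF balance_parameter_le[OF num_pendant_cases] power_increasing]) auto

lemma node_distance_pos: "i \<le> r \<Longrightarrow> 0 < node_distance i"
  using m_pos[of i] by (simp add: node_distance_def turning_distance_def)

lemma node_distance_less:
  assumes "1 \<le> i" "i \<le> r"
  shows "node_distance (i - 1) < k i + 1"
  using spacing[OF assms] node_distance_pos[OF assms(2)] by (simp add: node_distance_def)

lemma joining_potential_pos: "1 \<le> i \<Longrightarrow> i \<le> r \<Longrightarrow> 0 < joining_potential i j"
  by (simp add: joining_potential_def glued_solution_pos node_parameter_nonneg)

lemma joining_potential_supersolution:
  assumes "1 \<le> i" "i \<le> r"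
  shows "path_supersolution (3 / 2 * sqrt 2) (k i + 1) (joining_potential i)"
  unfolding joining_potential_def sqrt_2_plus_inverse[symmetric]
proof (rule path_supersolution_glued_solution)
  show "node_parameter i \<le> sqrt 2 ^ (2 * (k i + 1 - node_distance (i - 1)))"
    unfolding sqrt_2_power_even using spacing[OF assms]
    by (intro node_parameter_le) (simp add: node_distance_def)
qed (use assms node_distance_less[OF assms] in
    \<open>simp_all add: sqrt_2_power_even node_parameter_nonneg node_parameter_le node_distance_pos\<close>)

lemma joining_potential_first_ratio:
  assumes "i < r"
  shows "joining_potential (i + 1) 1 / joining_potential (i + 1) 0 =
    path_solution (sqrt 2) (node_parameter i) 1 / path_solution (sqrt 2) (node_parameter i) 0"
  unfolding joining_potential_def
  using assms glued_solution_first_ratio[of "sqrt 2" "node_parameter i" "node_distance i"]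
  by (simp add: node_parameter_nonneg node_distance_pos)

lemma joining_potential_last_ratio:
  assumes "1 \<le> i" "i \<le> r"
  shows "joining_potential i (k i) / joining_potential i (k i + 1) =
    path_solution (sqrt 2) (node_parameter i) 1 / path_solution (sqrt 2) (node_parameter i) 0"
  unfolding joining_potential_def
  using assms node_distance_less[OF assms] glued_solution_last_ratio[of
      "sqrt 2" "node_parameter (i - 1)" "node_parameter i" "node_distance (i - 1)" "k i + 1"]
  by (simp add: node_parameter_nonneg)

lemma pendant_potential_pos: "j \<le> m i \<Longrightarrow> 0 < pendant_potential i j"
  by (simp add: pendant_potential_def path_solution_minus_one_pos)

lemma pendant_potential_end: "pendant_potential i (m i + 1) = 0"
  by (simp add: pendant_potential_def path_solution_def)

lemma pendant_potential_supersolution: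
  "path_supersolution (3 / 2 * sqrt 2) (m i + 1) (pendant_potential i)"
  unfolding pendant_potential_def sqrt_2_plus_inverse[symmetric]
  by (intro path_supersolution_reverse path_supersolution_path_solution) simp

lemma potential_ratios_sum:
  assumes "i \<le> r"
  shows "real (num_pendant r i) * (pendant_potential i 1 / pendant_potential i 0) +
    (if 1 \<le> i then joining_potential i (k i) / joining_potential i (k i + 1) else 0) +
    (if i < r then joining_potential (i + 1) 1 / joining_potential (i + 1) 0 else 0) =
    3 / 2 * sqrt 2"
proof -
  define \<rho> where "\<rho> =
    path_solution (sqrt 2) (node_parameter i) 1 / path_solution (sqrt 2) (node_parameter i) 0"
  have "(if 1 \<le> i then joining_potential i (k i) / joining_potential i (k i + 1) else 0) +
      (if i < r then joining_potential (i + 1) 1 / joining_potential (i + 1) 0 else 0) =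
      real (3 - num_pendant r i) * \<rho>"
    using assms r_pos
      joining_potential_first_ratio[of i, folded \<rho>_def]
      joining_potential_last_ratio[of i, folded \<rho>_def]
    by (auto simp: num_pendant_def)
  moreover have "pendant_potential i 1 / pendant_potential i 0 =
      path_solution (sqrt 2) (-1) (m i) / path_solution (sqrt 2) (-1) (m i + 1)"
    by (simp add: pendant_potential_def)
  ultimately show ?thesis
    using node_balance[OF num_pendant_cases, of i "m i"]
    by (simp only: add.assoc flip: node_parameter_def \<rho>_def)
qed

sublocale open_quipu_potentials r m k joining_potential pendant_potential "3 / 2 * sqrt 2"
  by unfold_locales
    (simp_all only: m_pos joining_potential_pos pendant_potential_pos pendant_potential_end
      joining_potential_supersolution pendant_potential_supersolution potential_ratios_sum order_refl)

end

theorem theorem4p1: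
  fixes r :: nat and m k :: "nat \<Rightarrow> nat"
  assumes "r \<ge> 1"
    and "\<forall>i \<in> {0..r}. m i \<ge> 1"
    and "m 0 \<ge> 2" and "m r \<ge> 2"
    and "\<forall>i \<in> {2..r - 1}. k i \<ge> m (i - 1) + m i + 3"
    and "\<forall>j \<in> {1, r}. k j \<ge> m (j - 1) + m j + 1"
  shows "graph_spectral_radius (open_quipu r m k) < 3 / 2 * sqrt 2"
proof -
  let ?c = "graph_spectral_radius (open_quipu r m k)"
  interpret pair_graph "open_quipu r m k"
    by (rule pair_graph_open_quipu)
  have ev: "eigenvalue (adjacency_matrix (open_quipu r m k)) ?c"
    by (rule graph_spectral_radius_eigenvalue[OF pverts_open_quipu_not_empty])
  interpret well_spaced_quipu r m k
  proof
    fix i assume i: "1 \<le> i" "i \<le> r"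
    then have "i = 1 \<or> i = r \<or> i \<in> {2..r - 1}"
      by auto
    then show "turning_distance (num_pendant r (i - 1)) (m (i - 1)) +
        turning_distance (num_pendant r i) (m i) \<le> k i + 1"
      using assms(5,6) i by (fastforce simp: turning_distance_def num_pendant_def)
  qed (use assms in auto)
  have "\<bar>?c\<bar> \<le> 3 / 2 * sqrt 2"
    by (rule open_quipu_eigenvalue_abs_le[OF ev])
  moreover have "?c \<noteq> 3 / 2 * sqrt 2"
    using ev three_halves_sqrt_2_not_adjacency_eigenvalue by metis
  ultimately show ?thesis
    by simp
qed

end
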